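(* Let $r\ge 4$ be an integer and let $n$ be sufficiently large (depending on $r$). Then for every integer $\Delta$ with $n-1-\left\lfloor\frac{n-r}{r}\right\rfloor\le\Delta\le n-2$, $$ssat^{\Delta}(n,K_r)=(r-1)n-\frac{r(r-1)}{2},$$ except for $(r,\Delta)=(4,n-2)$, in which case $$ssat^{\Delta}(n,K_r)=(r-1)n-\frac{r(r-1)}{2}-1.$$
   Context: All graphs are finite and simple. A graph $G$ is $F$-semi-saturated if for every nonedge $e$ of $G$, the graph $G+e$ contains a copy of $F$ that is not contained in $G$ (a new copy of $F$). $ssat^{\Delta}(n,F)$ is the minimum number of edges of an $F$-semi-saturated graph $G$ on $n$ vertices with maximum degree $\Delta(G)\le\Delta$ (it is $\infty$ if no such graph exists). *)

theory Defs
  imports "HOL-Library.Ramsey" "HOL-Library.Extended_Nat"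
begin

text \<open>Finite simple graphs, as pairs of a vertex set and a set of two-element vertex sets.\<close>

type_synonym 'a graph = "'a set \<times> 'a set set"

abbreviation verts :: "'a graph \<Rightarrow> 'a set" where
  "verts G \<equiv> fst G"

abbreviation edges :: "'a graph \<Rightarrow> 'a set set" where
  "edges G \<equiv> snd G"

definition simple_graph :: "'a graph \<Rightarrow> bool" where
  "simple_graph G \<longleftrightarrow> finite (verts G) \<and> edges G \<subseteq> nsets (verts G) 2"

definition nonedges :: "'a graph \<Rightarrow> 'a set set" where
  "nonedges G = nsets (verts G) 2 - edges G"

definition add_edge :: "'a graph \<Rightarrow> 'a set \<Rightarrow> 'a graph" where
  "add_edge G e = (verts G, insert e (edges G))"

definition subgraph :: "'a graph \<Rightarrow> 'a graph \<Rightarrow> bool" where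
  "subgraph H G \<longleftrightarrow> simple_graph H \<and> verts H \<subseteq> verts G \<and> edges H \<subseteq> edges G"

definition isomorphic :: "'b graph \<Rightarrow> 'a graph \<Rightarrow> bool" where
  "isomorphic F H \<longleftrightarrow> (\<exists>f. bij_betw f (verts F) (verts H) \<and> edges H = (\<lambda>e. f ` e) ` edges F)"

text \<open>Copies are not required to be induced.\<close>

definition is_copy :: "'b graph \<Rightarrow> 'a graph \<Rightarrow> 'a graph \<Rightarrow> bool" where
  "is_copy F G H \<longleftrightarrow> subgraph H G \<and> isomorphic F H"

definition semi_saturated :: "'b graph \<Rightarrow> 'a graph \<Rightarrow> bool" where
  "semi_saturated F G \<longleftrightarrow>
    (\<forall>e \<in> nonedges G. \<exists>H. is_copy F (add_edge G e) H \<and> \<not> subgraph H G)"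

definition degree :: "'a graph \<Rightarrow> 'a \<Rightarrow> nat" where
  "degree G v = card {e \<in> edges G. v \<in> e}"

text \<open>The inserted 0 only matters for the graph without vertices.\<close>

definition max_degree :: "'a graph \<Rightarrow> nat" where
  "max_degree G = Max (insert 0 (degree G ` verts G))"

text \<open>
  As all notions above are invariant under isomorphism, it suffices to consider graphs with
  vertex set \<open>{..<n}\<close>. In \<^typ>\<open>enat\<close>, the infimum of the empty set is \<open>\<infinity>\<close>, and that of a
  nonempty set is its minimum.
\<close>

definition ssat :: "nat \<Rightarrow> nat \<Rightarrow> 'b graph \<Rightarrow> enat" where
  "ssat \<Delta> n F = Inf {enat (card (edges G)) | G :: nat graph.
     simple_graph G \<and> verts G = {..<n} \<and> semi_saturated F G \<and> max_degree G \<le> \<Delta>}"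

definition complete_graph :: "nat \<Rightarrow> nat graph" where
  "complete_graph r = ({..<r}, nsets {..<r} 2)"

end

theory Submission
  imports Defs
begin

text \<open>
  A graph is \<open>K\<^sub>r\<close>-semi-saturated iff the common neighbourhood of any two nonadjacent vertices
  contains a clique of size \<open>r - 2\<close>. Since \<open>\<Delta> \<le> n - 2\<close> excludes universal vertices, every vertex has a
  nonneighbour, hence degree at least \<open>r - 2\<close>. Degree exactly \<open>r - 2\<close> is impossible: all nonneighbours
  would contain the whole neighbourhood, a clique, and so make its vertices universal
  (\<open>card_nbhd_ge\<close>). The lower bound now depends on whether some vertex has degree \<open>r - 1\<close>.

  If all degrees are at least \<open>r\<close>, then \<open>n\<close> is bounded or there are at least \<open>(r - 1) n\<close> edges
  (\<open>card_V_le_of_min_degree\<close>). With few edges there is a vertex of small degree; call its closed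
  neighbourhood \<open>A\<close>. Every outside vertex has at least \<open>r - 2\<close> neighbours in \<open>A\<close>, so the weight that
  counts its edges to \<open>A\<close> fully and its other edges by half is at least \<open>r - 1\<close>. As the total excess
  is bounded, almost all outside vertices are tight: \<open>r - 2\<close> neighbours in \<open>A\<close> and two outside.
  Tight vertices that are far apart share only neighbours in \<open>A\<close>, so all have the same neighbourhood
  \<open>K\<close> there, a clique. A nonneighbour \<open>u\<close> of some \<open>k \<in> K\<close> and a tight vertex far from \<open>u\<close> and from
  the other exceptions cannot have a common clique of size \<open>r - 2\<close>.

  If \<open>y\<close> has degree \<open>r - 1\<close>, put \<open>T = N(y)\<close>, let \<open>B\<close> be the other vertices, and let \<open>D \<subseteq> B\<close> be the set of
  those with only \<open>r - 2\<close> neighbours in \<open>T\<close>; all others in \<open>B\<close> see all of \<open>T\<close>. Then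
  \<open>|E| = e(T) + e(B) + (r - 1) |B| - |D|\<close>, and the claim is \<open>e(T) + e(B) \<ge> |D| + (r - 1 choose 2)\<close>. If \<open>T\<close> is
  a clique, then each of its \<open>r - 1 \<ge> 3\<close> vertices is missed by some vertex of \<open>D\<close>, and vertices of \<open>D\<close>
  that miss different vertices are adjacent or have a common neighbour in \<open>B\<close>; this makes the graph
  on \<open>B\<close> so connected that \<open>e(B) \<ge> |D|\<close> (\<open>card_D_le_of_clique\<close>). If \<open>T\<close> is not a clique, then a vertex
  of \<open>T\<close> has no neighbour in \<open>T\<close>, and \<open>B\<close> must contain a clique of size \<open>r - 2\<close>
  (\<open>non_clique_case\<close>). That clique pays for the loss of \<open>r - 2\<close> edges in \<open>T\<close> iff
  \<open>(r - 2 choose 2) \<ge> r - 2\<close>, which fails only for \<open>r = 4\<close>, and there by one edge.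

  The bound is attained by a clique of size \<open>r\<close> with every further vertex joined to all but one of
  its vertices, the missed vertices being distributed evenly (\<open>residue_graph\<close>), and for \<open>r = 4\<close>,
  \<open>\<Delta> = n - 2\<close> by \<open>exceptional_graph\<close>.
\<close>

section \<open>Neighbourhoods and edge counts\<close>

definition nbhd :: "'a set set \<Rightarrow> 'a \<Rightarrow> 'a set" where
  "nbhd E v = {u. {u, v} \<in> E}"

definition edges_in :: "'a set set \<Rightarrow> 'a set \<Rightarrow> 'a set set" where
  "edges_in E X = {e \<in> E. e \<subseteq> X}"

lemma in_nbhd_iff: "u \<in> nbhd E v \<longleftrightarrow> {u, v} \<in> E"
  by (simp add: nbhd_def)

lemma nbhd_sym: "u \<in> nbhd E v \<longleftrightarrow> v \<in> nbhd E u"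
  by (simp add: nbhd_def insert_commute)

lemma nbhd_symD: "u \<in> nbhd E v \<Longrightarrow> v \<in> nbhd E u"
  by (simp add: nbhd_def insert_commute)

locale fin_graph =
  fixes V :: "'a set" and E :: "'a set set"
  assumes fin: "finite V" and edges: "E \<subseteq> nsets V 2"
begin

abbreviation "N \<equiv> nbhd E"
abbreviation "e_in X \<equiv> card (edges_in E X)"

lemma finite_E: "finite E"
  using fin edges finite_subset finite_imp_finite_nsets by blast

lemma finite_edges_in: "finite (edges_in E X)"
  using finite_E by (simp add: edges_in_def)

lemma nbhd_subset: "N v \<subseteq> V - {v}"
proof
  fix u assume "u \<in> N v"
  then have "{u, v} \<in> nsets V 2"
    using edges by (intro subsetD[OF edges]) (simp add: nbhd_def)
  then show "u \<in> V - {v}" by simp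
qed

lemma nbhd_irrefl: "v \<notin> N v"
  using nbhd_subset by blast

lemma finite_nbhd: "finite (N v)"
  using nbhd_subset fin finite_subset by blast

lemma degree_eq_card_nbhd: "degree (V, E) v = card (N v)"
proof -
  have "bij_betw (\<lambda>u. {u, v}) (N v) {e \<in> E. v \<in> e}"
    unfolding bij_betw_def
  proof
    show "inj_on (\<lambda>u. {u, v}) (N v)"
      by (auto simp: inj_on_def doubleton_eq_iff)
    show "(\<lambda>u. {u, v}) ` N v = {e \<in> E. v \<in> e}"
    proof
      show "{e \<in> E. v \<in> e} \<subseteq> (\<lambda>u. {u, v}) ` N v"
      proof
        fix e assume e: "e \<in> {e \<in> E. v \<in> e}"
        then obtain x y where "e = {x, y}"
          using edges by (blast elim: nsets2_E)
        with e have "\<exists>u. e = {u, v}"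
          by (metis (no_types, lifting) insertE insert_commute mem_Collect_eq singletonD)
        with e show "e \<in> (\<lambda>u. {u, v}) ` N v"
          by (auto simp: nbhd_def)
      qed
    qed (auto simp: nbhd_def)
  qed
  then show ?thesis
    by (simp add: degree_def bij_betw_same_card)
qed

lemma edges_in_V: "edges_in E V = E"
  using edges by (auto simp: edges_in_def nsets_def)

lemma e_in_empty: "e_in {} = 0"
  using edges by (auto simp: edges_in_def nsets_def)

lemma e_in_insert:
  assumes "v \<notin> X"
  shows "e_in (insert v X) = e_in X + card (N v \<inter> X)"
proof -
  have "edges_in E (insert v X) = edges_in E X \<union> (\<lambda>u. {u, v}) ` (N v \<inter> X)"
  proof
    show "edges_in E (insert v X) \<subseteq> edges_in E X \<union> (\<lambda>u. {u, v}) ` (N v \<inter> X)"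
    proof
      fix e assume e: "e \<in> edges_in E (insert v X)"
      then obtain x y where xy: "e = {x, y}" "x \<noteq> y"
        using edges unfolding edges_in_def by (blast elim: nsets2_E)
      with e show "e \<in> edges_in E X \<union> (\<lambda>u. {u, v}) ` (N v \<inter> X)"
        by (auto simp: edges_in_def nbhd_def image_iff doubleton_eq_iff insert_commute)
    qed
  qed (auto simp: edges_in_def nbhd_def insert_commute)
  moreover have "edges_in E X \<inter> (\<lambda>u. {u, v}) ` (N v \<inter> X) = {}"
    using assms by (auto simp: edges_in_def)
  moreover have "card ((\<lambda>u. {u, v}) ` (N v \<inter> X)) = card (N v \<inter> X)"
    by (rule card_image) (auto simp: inj_on_def doubleton_eq_iff)
  ultimately show ?thesis
    by (simp add: card_Un_disjoint finite_edges_in finite_nbhd)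
qed

lemma e_in_Un:
  assumes "finite Y" "X \<inter> Y = {}"
  shows "e_in (X \<union> Y) = e_in X + e_in Y + (\<Sum>v\<in>Y. card (N v \<inter> X))"
  using assms
proof (induction Y rule: finite_induct)
  case empty
  then show ?case by (simp add: e_in_empty)
next
  case (insert y Y)
  have "card (N y \<inter> (X \<union> Y)) = card (N y \<inter> X) + card (N y \<inter> Y)"
    using insert.prems by (subst card_Un_disjoint[symmetric]) (auto simp: finite_nbhd Int_Un_distrib)
  moreover have "e_in (insert y (X \<union> Y)) = e_in (X \<union> Y) + card (N y \<inter> (X \<union> Y))"
    using insert by (intro e_in_insert) auto
  ultimately show ?case
    using insert by (simp add: e_in_insert)
qed

lemma handshake:
  assumes "finite X"
  shows "(\<Sum>v\<in>X. card (N v \<inter> X)) = 2 * e_in X"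
  using assms
proof (induction X rule: finite_induct)
  case empty
  then show ?case by (simp add: e_in_empty)
next
  case (insert x X)
  have "card (N v \<inter> insert x X) = card (N v \<inter> X) + (if v \<in> N x then 1 else 0)" if "v \<in> X" for v
    using insert.hyps by (auto simp: nbhd_sym[of v] Int_insert_right finite_nbhd)
  then have "(\<Sum>v\<in>X. card (N v \<inter> insert x X)) = (\<Sum>v\<in>X. card (N v \<inter> X)) + card (N x \<inter> X)"
    using insert.hyps by (simp add: sum.distrib sum.If_cases Int_commute)
  moreover have "N x \<inter> insert x X = N x \<inter> X"
    using nbhd_irrefl by blast
  ultimately show ?case
    using insert by (simp add: e_in_insert)
qed

lemma e_in_clique:
  assumes "finite C" "C \<subseteq> V" "clique C E"
  shows "e_in C = card C choose 2"
proof -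
  have "edges_in E C = {e. e \<subseteq> C \<and> card e = 2}"
    using assms(3) edges by (auto simp: edges_in_def nsets_def card_2_iff clique_def)
  then show ?thesis
    using n_subsets[OF assms(1)] by simp
qed

end

text \<open>
  The hypothesis on the subsets of \<open>S\<close> says, for a graph \<open>F\<close>, that every vertex of \<open>S\<close> is joined by a path
  to a vertex outside \<open>S\<close>. The bound counts the edges of a spanning forest of \<open>S\<close> rooted outside \<open>S\<close>.
  The induction removes from \<open>S\<close> the endpoint of an edge with exactly one end in \<open>S\<close>; that edge no
  longer meets the smaller set.
\<close>

lemma card_le_card_edges_meeting:
  assumes "finite F" "finite S"
    and "\<And>U. U \<subseteq> S \<Longrightarrow> U \<noteq> {} \<Longrightarrow> \<exists>e\<in>F. \<exists>v. e \<inter> U = {v}"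
  shows "card S \<le> card {e \<in> F. e \<inter> S \<noteq> {}}"
  using assms(2,3)
proof (induction "card S" arbitrary: S)
  case 0
  then show ?case by simp
next
  case (Suc n)
  then have "S \<noteq> {}" by auto
  then obtain e v where ev: "e \<in> F" "e \<inter> S = {v}"
    using Suc.prems(2)[of S] by auto
  then have v: "v \<in> S" by blast
  have "card (S - {v}) \<le> card {e \<in> F. e \<inter> (S - {v}) \<noteq> {}}"
    using Suc.hyps(2) v Suc.prems by (intro Suc.hyps(1)) (auto intro: Suc.prems(2))
  also have "\<dots> < card {e \<in> F. e \<inter> S \<noteq> {}}"
    using ev assms(1) by (intro psubset_card_mono) auto
  finally show ?case
    using v Suc.prems(1) by (simp add: card_Diff_singleton)
qed

section \<open>Complete graphs and semi-saturation\<close>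

text \<open>
  A copy of \<open>K\<^sub>r\<close> is new iff it uses the added edge \<open>uv\<close>; its remaining \<open>r - 2\<close> vertices then form a
  clique in the common neighbourhood of \<open>u\<close> and \<open>v\<close>, and conversely.
\<close>

lemma semi_saturated_complete_graph_iff:
  assumes "simple_graph (V, E)" "r \<ge> 2"
  shows "semi_saturated (complete_graph r) (V, E) \<longleftrightarrow>
    (\<forall>u\<in>V. \<forall>v\<in>V. u \<noteq> v \<longrightarrow> {u, v} \<notin> E \<longrightarrow>
      (\<exists>Q. Q \<subseteq> nbhd E u \<inter> nbhd E v \<and> card Q = r - 2 \<and> clique Q E))" (is "?L \<longleftrightarrow> ?R")
proof -
  interpret fin_graph V E
    using assms(1) by unfold_locales (auto simp: simple_graph_def)
  show ?thesis
  proof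
    assume L: ?L
    show ?R
    proof (intro ballI impI)
      fix u v assume uv: "u \<in> V" "v \<in> V" "u \<noteq> v" "{u, v} \<notin> E"
      then obtain H where H: "is_copy (complete_graph r) (add_edge (V, E) {u, v}) H"
        and new: "\<not> subgraph H (V, E)"
        using L by (force simp: semi_saturated_def nonedges_def)
      obtain f where f: "bij_betw f {..<r} (verts H)"
        and eH: "edges H = (\<lambda>e. f ` e) ` nsets {..<r} 2"
        using H by (auto simp: is_copy_def isomorphic_def complete_graph_def)
      have eH: "edges H = nsets (verts H) 2"
        using bij_betw_nsets[OF f, of 2] eH by (simp add: bij_betw_def)
      have cH: "card (verts H) = r" "finite (verts H)"
        using bij_betw_same_card[OF f] bij_betw_finite[OF f] by auto
      have sub: "simple_graph H" "verts H \<subseteq> V" "edges H \<subseteq> insert {u, v} E"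
        using H by (auto simp: is_copy_def subgraph_def add_edge_def)
      then have "{u, v} \<in> edges H"
        using new by (auto simp: subgraph_def)
      then have uvH: "u \<in> verts H" "v \<in> verts H"
        using eH by auto
      have adj: "{x, y} \<in> E" if "x \<in> verts H" "y \<in> verts H" "x \<noteq> y" "x \<notin> {u, v}" for x y
      proof -
        have "{x, y} \<in> insert {u, v} E"
          using that(1-3) eH by (intro subsetD[OF sub(3)]) simp
        then show ?thesis using that by (auto simp: doubleton_eq_iff)
      qed
      show "\<exists>Q. Q \<subseteq> N u \<inter> N v \<and> card Q = r - 2 \<and> clique Q E"
        using adj uvH cH uv(3)
        by (intro exI[of _ "verts H - {u, v}"]) (auto simp: nbhd_def clique_def card_Diff_subset)
    qed
  next
    assume R: ?R
    show ?L
      unfolding semi_saturated_def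
    proof
      fix e assume "e \<in> nonedges (V, E)"
      then obtain u v where e: "e = {u, v}" and uv: "u \<in> V" "v \<in> V" "u \<noteq> v" "{u, v} \<notin> E"
        by (auto simp: nonedges_def elim!: nsets2_E)
      then obtain Q where Q: "Q \<subseteq> N u \<inter> N v" "card Q = r - 2" "clique Q E"
        using R by blast
      define X where "X = insert u (insert v Q)"
      have uvQ: "u \<notin> Q" "v \<notin> Q" "finite Q" "Q \<subseteq> V"
        using Q(1) nbhd_irrefl nbhd_subset finite_nbhd finite_subset by blast+
      then have cX: "card X = r" "finite X" "X \<subseteq> V"
        using Q(2) uv assms(2) by (auto simp: X_def)
      then obtain f where f: "bij_betw f {..<r} X"
        using ex_bij_betw_nat_finite[of X] by (auto simp: lessThan_atLeast0)
      have adjX: "{x, y} \<in> E" if "x \<in> Q" "y \<in> X" "x \<noteq> y" for x y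
        using that Q(1,3) by (auto simp: X_def in_nbhd_iff clique_def)
      have "nsets X 2 \<subseteq> insert e E"
      proof
        fix d assume "d \<in> nsets X 2"
        then obtain x y where "d = {x, y}" "x \<in> X" "y \<in> X" "x \<noteq> y"
          by (auto elim: nsets2_E)
        then show "d \<in> insert e E"
          using adjX[of x y] adjX[of y x] by (auto simp: X_def e insert_commute)
      qed
      then have "is_copy (complete_graph r) (add_edge (V, E) e) (X, nsets X 2)"
        using f cX bij_betw_imp_surj_on[OF bij_betw_nsets[OF f, of 2]]
        by (auto simp: is_copy_def subgraph_def simple_graph_def add_edge_def isomorphic_def
            complete_graph_def intro!: exI[of _ f])
      moreover have "\<not> subgraph (X, nsets X 2) (V, E)"
        using uv subsetD[of "nsets X 2" E "{u, v}"] by (auto simp: subgraph_def X_def)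
      ultimately show "\<exists>H. is_copy (complete_graph r) (add_edge (V, E) e) H \<and> \<not> subgraph H (V, E)"
        by blast
    qed
  qed
qed

locale nonuniversal_semisat = fin_graph V E for V :: "'a set" and E +
  fixes r :: nat
  assumes r4: "r \<ge> 4"
    and sat: "\<And>u v. u \<in> V \<Longrightarrow> v \<in> V \<Longrightarrow> u \<noteq> v \<Longrightarrow> u \<notin> N v \<Longrightarrow>
      \<exists>Q. Q \<subseteq> N u \<inter> N v \<and> card Q = r - 2 \<and> clique Q E"
    and nonuniversal: "\<And>v. v \<in> V \<Longrightarrow> \<exists>w\<in>V. w \<noteq> v \<and> w \<notin> N v"
begin

text \<open>
  A nonneighbour of \<open>v\<close> gives a clique of size \<open>r - 2\<close> inside the neighbourhood of \<open>v\<close>. If that were the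
  whole neighbourhood, each vertex \<open>q\<close> of it would be adjacent to all nonneighbours of \<open>v\<close> as well, hence
  universal.
\<close>

lemma card_nbhd_ge:
  assumes "v \<in> V"
  shows "r - 1 \<le> card (N v)"
proof -
  obtain w where w: "w \<in> V" "w \<noteq> v" "w \<notin> N v"
    using nonuniversal assms by blast
  then obtain Q where Q: "Q \<subseteq> N w \<inter> N v" "card Q = r - 2" "clique Q E"
    using sat assms by blast
  have le: "r - 2 \<le> card (N v)"
    using Q card_mono[of "N v" Q] finite_nbhd by auto
  have "card (N v) \<noteq> r - 2"
  proof
    assume eq: "card (N v) = r - 2"
    then have NvQ: "N v = Q"
      using Q by (metis card_subset_eq finite_nbhd le_inf_iff)
    obtain q where q: "q \<in> Q"
      using Q(2) r4 by fastforce
    then have "q \<in> V" "q \<in> N v"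
      using NvQ nbhd_subset by blast+
    then obtain w' where w': "w' \<in> V" "w' \<noteq> q" "w' \<notin> N q"
      using nonuniversal by blast
    have "w' \<notin> N v"
      using w' Q(3) q NvQ by (auto simp: clique_def in_nbhd_iff)
    moreover have "w' \<noteq> v"
      using w'(3) nbhd_symD[OF \<open>q \<in> N v\<close>] by blast
    ultimately obtain Q' where "Q' \<subseteq> N w' \<inter> N v" "card Q' = r - 2"
      using sat w'(1) assms by blast
    then have "N v \<subseteq> N w'"
      using eq by (metis card_subset_eq finite_nbhd le_inf_iff)
    then show False
      using \<open>q \<in> N v\<close> w'(3) nbhd_symD[of q E w'] by blast
  qed
  with le show ?thesis by simp
qed

end

section \<open>Graphs with a vertex of degree \<open>r - 1\<close>\<close>

locale min_degree_vertex = nonuniversal_semisat V E r for V :: "'a set" and E r +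
  fixes y
  assumes y: "y \<in> V" and card_nbhd_y: "card (N y) = r - 1"
begin

text \<open>
  \<open>T\<close> catches a large clique of every neighbourhood: a vertex of \<open>B\<close> other than \<open>y\<close> is not adjacent to
  \<open>y\<close>. So it sees all of \<open>T\<close> or all but one vertex, and \<open>D\<close> collects the deficient ones.
\<close>

definition "T = N y"
definition "B = V - T"
definition "D = {v \<in> B. card (N v \<inter> T) = r - 2}"

lemma card_T: "card T = r - 1" and finite_T: "finite T" and T_V: "T \<subseteq> V"
  using card_nbhd_y finite_nbhd nbhd_subset by (auto simp: T_def)

lemma finite_B: "finite B" and B_V: "B \<subseteq> V" and y_B: "y \<in> B"
  using fin y nbhd_irrefl by (auto simp: B_def T_def)

lemma D_B: "D \<subseteq> B" and finite_D: "finite D"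
  using finite_B by (auto simp: D_def)

lemma clique_in_nbhd_T:
  assumes "v \<in> B"
  shows "\<exists>Q. Q \<subseteq> N v \<inter> T \<and> card Q = r - 2 \<and> clique Q E"
proof (cases "v = y")
  case True
  obtain w where w: "w \<in> V" "w \<noteq> y" "w \<notin> N y"
    using nonuniversal[OF y] by blast
  obtain Q where "Q \<subseteq> N w \<inter> N y" "card Q = r - 2" "clique Q E"
    using sat[OF w(1) y w(2,3)] by blast
  then show ?thesis
    using True by (intro exI[of _ Q]) (auto simp: T_def)
next
  case False
  then show ?thesis
    using sat[of v y] assms y unfolding T_def B_def by blast
qed

lemma card_nbhd_T:
  assumes "v \<in> B"
  shows "card (N v \<inter> T) + (if v \<in> D then 1 else 0) = r - 1"
proof -
  obtain Q where "Q \<subseteq> N v \<inter> T" "card Q = r - 2"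
    using clique_in_nbhd_T[OF assms] by blast
  then have "r - 2 \<le> card (N v \<inter> T)"
    using card_mono[of "N v \<inter> T" Q] finite_T by simp
  moreover have "card (N v \<inter> T) \<le> r - 1"
    using card_mono[of T "N v \<inter> T"] finite_T card_T by simp
  ultimately show ?thesis
    using assms r4 by (auto simp: D_def)
qed

lemma T_subset_nbhd:
  assumes "v \<in> B - D"
  shows "T \<subseteq> N v"
proof -
  have "card (N v \<inter> T) = card T"
    using card_nbhd_T[of v] assms card_T by simp
  then have "N v \<inter> T = T"
    using finite_T by (intro card_subset_eq) simp_all
  then show ?thesis by blast
qed

lemma missed_vertex:
  assumes "v \<in> D"
  obtains t where "t \<in> T" "N v \<inter> T = T - {t}" "clique (T - {t}) E"
proof -
  obtain Q where Q: "Q \<subseteq> N v \<inter> T" "card Q = r - 2" "clique Q E"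
    using clique_in_nbhd_T[of v] assms D_B by blast
  moreover have "card (N v \<inter> T) = r - 2"
    using assms by (simp add: D_def)
  ultimately have Qeq: "Q = N v \<inter> T"
    using finite_T by (intro card_subset_eq) auto
  have "card (T - N v \<inter> T) = 1"
    using card_T Q(2) Qeq finite_T r4 by (subst card_Diff_subset) auto
  then obtain t where "T - N v \<inter> T = {t}"
    using card_1_singletonE by blast
  then have "t \<in> T" "N v \<inter> T = T - {t}" by auto
  with that Q(3) Qeq show ?thesis by simp
qed

lemma card_E_plus_card_D: "card E + card D = e_in T + e_in B + (r - 1) * card B"
proof -
  have "(\<Sum>v\<in>B. card (N v \<inter> T)) + card D = (\<Sum>v\<in>B. card (N v \<inter> T) + (if v \<in> D then 1 else 0))"
    using finite_B D_B by (simp add: sum.distrib sum.If_cases Int_absorb1)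
  also have "\<dots> = (r - 1) * card B"
    using card_nbhd_T by simp
  finally show ?thesis
    using e_in_Un[of B T] finite_B T_V edges_in_V by (simp add: B_def Un_absorb1)
qed

lemma D_has_nbr_in_B:
  assumes "v \<in> D"
  shows "N v \<inter> B \<noteq> {}"
proof
  assume "N v \<inter> B = {}"
  then have "N v \<inter> T = N v"
    using nbhd_subset by (auto simp: B_def)
  then show False
    using assms card_nbhd_ge[of v] r4 B_V by (auto simp: D_def)
qed

text \<open>
  Let \<open>a, b \<in> T\<close> be nonadjacent, where \<open>T - {a}\<close> is the clique of size \<open>r - 2\<close> that \<open>T\<close> contains. A neighbour
  \<open>t\<close> of \<open>a\<close> in \<open>T\<close> would be missed by some vertex of \<open>D\<close>, so \<open>T - {t}\<close> would be a clique containing both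
  \<open>a\<close> and \<open>b\<close>. Hence \<open>a\<close> has no neighbours in \<open>T\<close>, and this forces all of \<open>D\<close> to miss \<open>a\<close>. The
  common cliques of \<open>a\<close> with \<open>b\<close> and with the vertices of \<open>D\<close> therefore lie in \<open>B - D\<close>, which yields
  \<open>e(T) + e(B) \<ge> 2 (r - 2 choose 2) + (r - 2) |D|\<close>. This is too small only if \<open>r = 4\<close> and \<open>D\<close> is empty, and
  then \<open>b\<close> is adjacent to everything except \<open>a\<close>.
\<close>

lemma non_clique_case:
  assumes "\<not> clique T E"
  shows "card D + (r - 1 choose 2) \<le> e_in T + e_in B \<or>
    r = 4 \<and> card D + 2 \<le> e_in T + e_in B \<and> (\<exists>b\<in>V. card V - 2 \<le> card (N b))"
proof -
  obtain Q where Q: "Q \<subseteq> T" "card Q = r - 2" "clique Q E"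
    using clique_in_nbhd_T[OF y_B] by blast
  have "card (T - Q) = 1"
    using card_T Q r4 finite_subset[OF Q(1) finite_T] by (subst card_Diff_subset) auto
  then obtain a where a: "T - Q = {a}"
    using card_1_singletonE by blast
  then have aT: "a \<in> T" and Qa: "Q = T - {a}"
    using Q by auto
  obtain c d where cd: "c \<in> T" "d \<in> T" "c \<noteq> d" "{c, d} \<notin> E"
    using assms by (auto simp: clique_def)
  then have "c = a \<or> d = a"
    using Q(3) by (auto simp: clique_def Qa)
  with cd obtain b where b: "b \<in> T" "b \<noteq> a" "b \<notin> N a"
    by (metis in_nbhd_iff insert_commute)
  have no_nbr: "N a \<inter> T = {}"
  proof (rule ccontr)
    assume "N a \<inter> T \<noteq> {}"
    then obtain t where t: "t \<in> N a" "t \<in> T" by blast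
    then have "t \<noteq> a" "t \<noteq> b"
      using nbhd_irrefl b by auto
    obtain w where w: "w \<in> V" "w \<noteq> t" "w \<notin> N t"
      using nonuniversal t(2) T_V by blast
    have "w \<notin> T"
    proof
      assume "w \<in> T"
      moreover have "w \<noteq> a" using w(3) nbhd_symD[OF t(1)] by blast
      ultimately show False
        using Q(3) w \<open>t \<noteq> a\<close> t(2) by (auto simp: clique_def Qa in_nbhd_iff)
    qed
    moreover have "\<not> T \<subseteq> N w"
      using w(3) t(2) nbhd_symD[of t E w] by blast
    ultimately have "w \<in> D"
      using T_subset_nbhd w(1) by (auto simp: B_def)
    then obtain s where s: "s \<in> T" "N w \<inter> T = T - {s}" "clique (T - {s}) E"
      by (rule missed_vertex)
    have "s = t"
      using s w(3) t(2) nbhd_symD[of t E w] by blast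
    then have "{b, a} \<in> E"
      using s(3) \<open>t \<noteq> a\<close> \<open>t \<noteq> b\<close> b aT by (auto simp: clique_def)
    then show False
      using b by (simp add: in_nbhd_iff)
  qed
  have D_miss: "a \<notin> N v" if v: "v \<in> D" for v
  proof
    assume av: "a \<in> N v"
    obtain s where s: "s \<in> T" "N v \<inter> T = T - {s}" "clique (T - {s}) E"
      using v by (rule missed_vertex)
    have "a \<noteq> s" using s av aT by blast
    have "card (T - {a, s}) = r - 3"
      using card_T aT s \<open>a \<noteq> s\<close> finite_T by (subst card_Diff_subset) auto
    then have "T - {a, s} \<noteq> {}"
      using r4 by (intro notI) simp
    then obtain c where c: "c \<in> T - {a, s}"
      by blast
    then have "c \<in> N a"
      using s(3) aT \<open>a \<noteq> s\<close> by (auto simp: clique_def in_nbhd_iff)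
    then show False using no_nbr c by blast
  qed
  have cliqueB: "\<exists>C. C \<subseteq> N u \<inter> (B - D) \<and> card C = r - 2 \<and> clique C E"
    if u: "u \<in> V" "u \<noteq> a" "u \<notin> N a" for u
  proof -
    have "a \<in> V" using aT T_V by blast
    then obtain C where C: "C \<subseteq> N u \<inter> N a" "card C = r - 2" "clique C E"
      using sat[OF u(1) _ u(2,3)] by blast
    have "C \<subseteq> N u \<inter> (B - D)"
    proof
      fix x assume "x \<in> C"
      then have x: "x \<in> N u" "x \<in> N a" using C(1) by auto
      then have "x \<notin> D" using D_miss[of x] nbhd_symD[OF x(2)] by blast
      moreover have "x \<in> B"
        using no_nbr x(2) nbhd_subset[of a] unfolding B_def by blast
      ultimately show "x \<in> N u \<inter> (B - D)" using x(1) by blast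
    qed
    with C(2,3) show ?thesis by blast
  qed
  obtain C where C: "C \<subseteq> B - D" "card C = r - 2" "clique C E"
    using cliqueB[of b] b T_V by blast
  have "r - 2 \<le> card (N v \<inter> (B - D))" if "v \<in> D" for v
  proof -
    have "v \<noteq> a" "v \<in> V" "v \<notin> N a"
      using that D_miss[of v] aT B_V D_B nbhd_symD[of v E a] by (auto simp: B_def)
    then obtain C where "C \<subseteq> N v \<inter> (B - D)" "card C = r - 2"
      using cliqueB by blast
    then show ?thesis
      using card_mono[of "N v \<inter> (B - D)" C] finite_B by auto
  qed
  then have "(\<Sum>v\<in>D. r - 2) \<le> (\<Sum>v\<in>D. card (N v \<inter> (B - D)))"
    by (rule sum_mono)
  moreover have "e_in B = e_in (B - D) + e_in D + (\<Sum>v\<in>D. card (N v \<inter> (B - D)))"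
    using e_in_Un[OF finite_D, of "B - D"] D_B by (simp add: Un_absorb2 Int_commute)
  moreover have "e_in C \<le> e_in (B - D)"
    using C(1) finite_edges_in by (intro card_mono) (auto simp: edges_in_def)
  moreover have "e_in C = r - 2 choose 2"
    using e_in_clique[of C] finite_subset[OF C(1)] finite_B C B_V by auto
  moreover have "e_in Q \<le> e_in T"
    using Q(1) finite_edges_in by (intro card_mono) (auto simp: edges_in_def)
  moreover have "e_in Q = r - 2 choose 2"
    using e_in_clique[of Q] finite_subset[OF Q(1) finite_T] Q T_V by auto
  ultimately have main: "2 * (r - 2 choose 2) + (r - 2) * card D \<le> e_in T + e_in B"
    by (simp add: mult.commute)
  obtain k where k: "r = k + 4"
    using r4 le_Suc_ex by (metis add.commute)
  have Suc_choose_2: "Suc n choose 2 = (n choose 2) + n" for n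
    by (simp add: numeral_2_eq_2)
  have "r - 1 = Suc (r - 2)" "r - 2 = Suc (Suc k)"
    using k by simp_all
  then have ch: "r - 1 choose 2 = (r - 2 choose 2) + (r - 2)"
    by (simp only: Suc_choose_2)
  show ?thesis
  proof (cases "r = 4 \<and> D = {}")
    case False
    have "card D + (r - 2) \<le> (r - 2 choose 2) + (r - 2) * card D"
    proof (cases "k = 0")
      case True
      then have "card D \<ge> 1"
        using False k finite_D by (simp add: Suc_leI card_gt_0_iff)
      then show ?thesis using True k by simp
    next
      case k0: False
      then obtain j where "k = Suc j" using not0_implies_Suc by blast
      then have "r - 2 \<le> r - 2 choose 2"
        unfolding \<open>r - 2 = Suc (Suc k)\<close> by (simp add: Suc_choose_2)
      moreover have "card D \<le> (r - 2) * card D"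
        using k by simp
      ultimately show ?thesis by linarith
    qed
    then show ?thesis using main ch by linarith
  next
    case True
    have "V - {a, b} \<subseteq> N b"
    proof
      fix v assume v: "v \<in> V - {a, b}"
      show "v \<in> N b"
      proof (cases "v \<in> T")
        case True
        then show ?thesis
          using Q(3) v b by (auto simp: clique_def Qa in_nbhd_iff)
      next
        case False
        then have "b \<in> N v"
          using T_subset_nbhd[of v] v b \<open>r = 4 \<and> D = {}\<close> by (auto simp: B_def)
        then show ?thesis by (rule nbhd_symD)
      qed
    qed
    then have "card (V - {a, b}) \<le> card (N b)"
      by (intro card_mono finite_nbhd)
    moreover have "card (V - {a, b}) = card V - 2"
      using aT b T_V by (subst card_Diff_subset) auto
    moreover have "card D + 2 \<le> e_in T + e_in B"
      using main True by simp
    ultimately show ?thesis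
      using True b T_V by auto
  qed
qed

definition "miss v = (SOME t. t \<in> T - N v)"

lemma miss:
  assumes "v \<in> D"
  shows "miss v \<in> T" "N v \<inter> T = T - {miss v}"
proof -
  obtain t where t: "t \<in> T" "N v \<inter> T = T - {t}"
    using missed_vertex[OF assms] by blast
  then have "T - N v = {t}" by blast
  then have "miss v = t" by (simp add: miss_def)
  with t show "miss v \<in> T" "N v \<inter> T = T - {miss v}" by simp_all
qed

text \<open>
  Deficient vertices that miss different vertices of \<open>T\<close> have only \<open>r - 3\<close> common neighbours in \<open>T\<close>, so a
  common clique of size \<open>r - 2\<close> needs a vertex of \<open>B\<close>. If only \<open>b\<close> is available, the clique uses
  all \<open>r - 3\<close> of them.
\<close>

lemma common_nbr_in_B:
  assumes uv: "u \<in> D" "v \<in> D" "miss u \<noteq> miss v" "u \<notin> N v"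
  shows "\<exists>b\<in>B. b \<in> N u \<and> b \<in> N v"
    and "N u \<inter> N v \<inter> B \<subseteq> {b} \<Longrightarrow> T - {miss u, miss v} \<subseteq> N b"
proof -
  let ?R = "T - {miss u, miss v}"
  have "u \<in> V" "v \<in> V" "u \<noteq> v"
    using uv D_B B_V by auto
  then obtain Q where Q: "Q \<subseteq> N u \<inter> N v" "card Q = r - 2" "clique Q E"
    using sat uv(4) by blast
  have QR: "Q \<subseteq> ?R \<union> (N u \<inter> N v \<inter> B)"
    using Q(1) miss(2)[OF uv(1)] miss(2)[OF uv(2)] nbhd_subset[of u] by (auto simp: B_def)
  have cR: "card ?R = r - 3"
    using card_T miss(1)[OF uv(1)] miss(1)[OF uv(2)] uv(3) finite_T
    by (subst card_Diff_subset) auto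
  have not_R: "\<not> Q \<subseteq> ?R"
  proof
    assume "Q \<subseteq> ?R"
    then have "card Q \<le> card ?R"
      using finite_T by (intro card_mono) auto
    then show False using Q(2) cR r4 by simp
  qed
  then show "\<exists>b\<in>B. b \<in> N u \<and> b \<in> N v"
    using QR by blast
  assume b: "N u \<inter> N v \<inter> B \<subseteq> {b}"
  then have "Q \<subseteq> insert b ?R"
    using QR by blast
  moreover have "card (insert b ?R) \<le> r - 2"
    using card_insert_le_m1[of "r - 2" ?R b] cR r4 by simp
  ultimately have "Q = insert b ?R"
    using Q(2) finite_T by (intro card_seteq) auto
  moreover have "b \<notin> ?R"
    using b not_R QR by (auto simp: B_def)
  ultimately show "?R \<subseteq> N b"
    using Q(3) by (auto simp: clique_def in_nbhd_iff)
qed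

lemma all_missed:
  assumes "clique T E" "t \<in> T"
  obtains v where "v \<in> D" "miss v = t"
proof -
  obtain w where w: "w \<in> V" "w \<noteq> t" "w \<notin> N t"
    using nonuniversal assms(2) T_V by blast
  have "w \<notin> T"
    using assms w by (auto simp: clique_def in_nbhd_iff)
  moreover have tw: "t \<notin> N w"
    using w(3) nbhd_symD[of t E w] by blast
  ultimately have "w \<in> D"
    using T_subset_nbhd[of w] w(1) assms(2) by (auto simp: B_def)
  moreover from this have "miss w = t"
    using miss(2)[of w] tw assms(2) by blast
  ultimately show ?thesis
    by (rule that)
qed

text \<open>
  If every vertex of \<open>D\<close> has two neighbours in \<open>B\<close>, the handshake lemma suffices. Otherwise let \<open>l \<in> D\<close> have
  a single neighbour \<open>z\<close> in \<open>B\<close>, and let \<open>l\<close> miss \<open>t\<close>. Then \<open>z\<close> is the only possible common neighbour of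
  \<open>l\<close> in \<open>B\<close>, so it is adjacent to every other vertex of \<open>D\<close> that does not miss \<open>t\<close>, and
  those that miss \<open>t\<close> are at distance at most two from these. So paths lead from all of \<open>D\<close> to \<open>z\<close>, and
  a spanning tree rooted at \<open>z\<close> has \<open>|D|\<close> edges if \<open>z \<notin> D\<close>. If \<open>z \<in> D\<close>, the tree gives only \<open>|D| - 1\<close>
  edges, and a cycle through \<open>z\<close> supplies another one.
\<close>

lemma card_D_le_of_clique:
  assumes T: "clique T E"
  shows "card D \<le> e_in B"
proof (cases "\<forall>v\<in>D. 2 \<le> card (N v \<inter> B)")
  case True
  then have "(\<Sum>v\<in>D. 2) \<le> (\<Sum>v\<in>D. card (N v \<inter> B))"
    by (intro sum_mono) auto
  also have "\<dots> \<le> (\<Sum>v\<in>B. card (N v \<inter> B))"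
    using finite_B D_B by (intro sum_mono2) auto
  finally show ?thesis
    using handshake[OF finite_B] by simp
next
  case False
  then obtain l where l: "l \<in> D" "card (N l \<inter> B) < 2"
    by (auto simp: not_le)
  moreover have "card (N l \<inter> B) \<noteq> 0"
    using D_has_nbr_in_B[OF l(1)] finite_nbhd by simp
  ultimately have "card (N l \<inter> B) = 1" by simp
  then obtain z where z: "N l \<inter> B = {z}"
    using card_1_singletonE by blast
  then have zB: "z \<in> B" by blast
  define t where "t = miss l"
  have tT: "t \<in> T" using miss(1) l(1) by (simp add: t_def)
  have z_adj: "z \<in> N v" and z_T: "T - {t, miss v} \<subseteq> N z"
    if "v \<in> D" "miss v \<noteq> t" "v \<noteq> z" for v
  proof -
    have "v \<notin> N l"
      using z that D_B by blast
    then have lv: "l \<notin> N v"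
      using nbhd_symD[of l E v] by blast
    show "z \<in> N v"
      using common_nbr_in_B(1)[OF l(1) that(1) _ lv] that(2) z by (auto simp: t_def)
    show "T - {t, miss v} \<subseteq> N z"
      using common_nbr_in_B(2)[OF l(1) that(1) _ lv, of z] that(2) z by (auto simp: t_def)
  qed
  have two: "\<exists>s\<in>T. s \<noteq> t \<and> s \<noteq> t'" for t'
  proof (rule ccontr)
    assume "\<not> ?thesis"
    then have "T \<subseteq> {t, t'}" by blast
    then have "card T \<le> card {t, t'}" by (intro card_mono) auto
    also have "\<dots> \<le> 2" by (simp add: card_insert_if)
    finally show False using card_T r4 by simp
  qed
  have crossing: "\<exists>u\<in>U. \<exists>b\<in>B - U. b \<in> N u \<and> (b = x \<or> u \<notin> N x)"
    if U: "U \<subseteq> D" "U \<noteq> {}" "\<And>u. u \<in> U \<Longrightarrow> miss u = t" and x: "x \<in> D" "miss x \<noteq> t" for U x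
  proof -
    obtain u where u: "u \<in> U" using U(2) by blast
    have xU: "x \<in> B - U" using x U(3)[of x] D_B by blast
    have "u \<in> D" "miss u \<noteq> miss x" using u U(1) U(3)[OF u] x(2) by auto
    note common = common_nbr_in_B(1)[OF \<open>u \<in> D\<close> x(1) \<open>miss u \<noteq> miss x\<close>]
    show ?thesis
    proof (cases "u \<in> N x")
      case True
      then show ?thesis using u xU nbhd_symD[of u E x] by blast
    next
      case False
      then obtain b where b: "b \<in> B" "b \<in> N u" "b \<in> N x"
        using common by blast
      then show ?thesis using u xU False nbhd_symD[of b E x] by blast
    qed
  qed
  have star: "{z, x} \<in> edges_in E B" if "x \<in> D" "miss x \<noteq> t" "x \<noteq> z" for x
    using z_adj[OF that] zB that(1) D_B by (auto simp: edges_in_def in_nbhd_iff)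
  show ?thesis
  proof (cases "z \<in> D")
    case False
    have "card D \<le> card {e \<in> edges_in E B. e \<inter> D \<noteq> {}}"
    proof (rule card_le_card_edges_meeting[OF finite_edges_in finite_D])
      fix U assume U: "U \<subseteq> D" "U \<noteq> {}"
      show "\<exists>e\<in>edges_in E B. \<exists>v. e \<inter> U = {v}"
      proof (cases "\<exists>x\<in>U. miss x \<noteq> t")
        case True
        then obtain x where x: "x \<in> U" "miss x \<noteq> t" by blast
        then have "{z, x} \<in> edges_in E B"
          using star[of x] U False by blast
        moreover have "{z, x} \<inter> U = {x}" using x U False by blast
        ultimately show ?thesis by blast
      next
        case same: False
        obtain s where "s \<in> T" "s \<noteq> t" using two by blast
        then obtain x where "x \<in> D" "miss x \<noteq> t"
          using all_missed[OF T, of s] by blast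
        then obtain u b where ub: "u \<in> U" "b \<in> B - U" "b \<in> N u"
          using crossing[of U x] U same by blast
        then have "{b, u} \<in> edges_in E B"
          using U D_B by (auto simp: edges_in_def in_nbhd_iff)
        moreover have "{b, u} \<inter> U = {u}" using ub by blast
        ultimately show ?thesis by blast
      qed
    qed
    also have "\<dots> \<le> e_in B"
      using finite_edges_in by (intro card_mono) auto
    finally show ?thesis .
  next
    case zD: True
    \<comment> \<open>Otherwise a vertex of \<open>D\<close> missing a third vertex of \<open>T\<close> forces \<open>z\<close> to be adjacent to \<open>miss z\<close>.\<close>
    have miss_z: "miss z = t"
    proof (rule ccontr)
      assume ne: "miss z \<noteq> t"
      obtain s where s: "s \<in> T" "s \<noteq> t" "s \<noteq> miss z" using two by blast
      obtain v where v: "v \<in> D" "miss v = s" using all_missed[OF T s(1)] by blast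
      then have "T - {t, s} \<subseteq> N z" using z_T[of v] s by auto
      then have "miss z \<in> N z \<inter> T" using miss(1)[OF zD] ne s by blast
      then show False using miss(2)[OF zD] by blast
    qed
    obtain s1 where s1: "s1 \<in> T" "s1 \<noteq> t" using two by blast
    obtain s2 where s2: "s2 \<in> T" "s2 \<noteq> t" "s2 \<noteq> s1" using two by blast
    obtain x1 where x1: "x1 \<in> D" "miss x1 = s1" using all_missed[OF T s1(1)] by blast
    obtain x2 where x2: "x2 \<in> D" "miss x2 = s2" using all_missed[OF T s2(1)] by blast
    have ne: "x1 \<noteq> x2" "x1 \<noteq> z" "x2 \<noteq> z"
      using x1 x2 s1 s2 miss_z by auto
    \<comment> \<open>The edge \<open>c x1\<close> closes a triangle or a 4-cycle with \<open>z\<close> and \<open>x2\<close>. The spanning tree can avoid it: use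
      edges at \<open>z\<close> for the vertices that do not miss \<open>t\<close>, and connect the others through \<open>x2\<close>.\<close>
    obtain c where c: "c \<in> B" "c \<noteq> z" "c \<in> N x1" "c = x2 \<or> c \<in> N x2"
    proof (cases "x1 \<in> N x2")
      case True
      then show ?thesis
        using x2(1) ne(3) D_B by (intro that[of x2]) (auto intro: nbhd_symD)
    next
      case False
      have "\<not> T - {miss x1, miss x2} \<subseteq> N z"
      proof
        assume "T - {miss x1, miss x2} \<subseteq> N z"
        then have "t \<in> N z \<inter> T" using tT s1(2) s2(2) x1(2) x2(2) by blast
        then show False using miss(2)[OF zD] miss_z by blast
      qed
      then have "\<not> N x1 \<inter> N x2 \<inter> B \<subseteq> {z}"
        using common_nbr_in_B(2)[OF x1(1) x2(1) _ False, of z] x1(2) x2(2) s2(3) by auto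
      then obtain d where "d \<in> N x1 \<inter> N x2 \<inter> B" "d \<noteq> z"
        by blast
      then show ?thesis
        by (intro that[of d]) simp_all
    qed
    let ?f = "{c, x1}"
    have f: "?f \<in> edges_in E B"
      using c x1 D_B by (auto simp: edges_in_def in_nbhd_iff)
    have "card (D - {z}) \<le> card {e \<in> edges_in E B - {?f}. e \<inter> (D - {z}) \<noteq> {}}"
    proof (rule card_le_card_edges_meeting)
      fix U assume U: "U \<subseteq> D - {z}" "U \<noteq> {}"
      show "\<exists>e\<in>edges_in E B - {?f}. \<exists>v. e \<inter> U = {v}"
      proof (cases "\<exists>x\<in>U. miss x \<noteq> t")
        case True
        then obtain x where x: "x \<in> U" "miss x \<noteq> t" by blast
        then have "{z, x} \<in> edges_in E B - {?f}"
          using star[of x] U c(2) ne by (auto simp: doubleton_eq_iff)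
        moreover have "{z, x} \<inter> U = {x}" using x U by blast
        ultimately show ?thesis by blast
      next
        case same: False
        then obtain u b where ub: "u \<in> U" "b \<in> B - U" "b \<in> N u" "b = x2 \<or> u \<notin> N x2"
          using crossing[of U x2] U x2 s2 by blast
        then have "{b, u} \<in> edges_in E B"
          using U D_B by (auto simp: edges_in_def in_nbhd_iff)
        moreover have "{b, u} \<noteq> ?f"
          using same ub x1 x2 s1 s2 c(4) by (auto simp: doubleton_eq_iff)
        moreover have "{b, u} \<inter> U = {u}" using ub by blast
        ultimately show ?thesis by blast
      qed
    qed (simp_all add: finite_edges_in finite_D)
    also have "\<dots> \<le> card (edges_in E B - {?f})"
      using finite_edges_in by (intro card_mono) auto
    also have "\<dots> = e_in B - 1"
      using f finite_edges_in by simp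
    finally have "card D - 1 \<le> e_in B - 1"
      using zD finite_D by simp
    moreover have "0 < e_in B"
      using f finite_edges_in by (auto simp: card_gt_0_iff)
    ultimately show ?thesis by linarith
  qed
qed

lemma card_E_ge:
  "(r - 1) * card B + (r - 1 choose 2) \<le> card E \<or>
    r = 4 \<and> (r - 1) * card B + 2 \<le> card E \<and> (\<exists>b\<in>V. card V - 2 \<le> card (N b))"
proof (cases "clique T E")
  case True
  then have "e_in T = r - 1 choose 2"
    using e_in_clique finite_T T_V card_T by simp
  then show ?thesis
    using card_D_le_of_clique[OF True] card_E_plus_card_D by linarith
next
  case False
  then show ?thesis
    using non_clique_case card_E_plus_card_D by fastforce
qed

lemma card_B: "card B + (r - 1) = card V"
  using card_T T_V finite_T fin card_mono[OF fin T_V] by (simp add: B_def card_Diff_subset)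

end

section \<open>Graphs with minimum degree at least \<open>r\<close>\<close>

text \<open>
  In the argument below, \<open>2 (r - 1)\<close> bounds the size of the closed neighbourhood \<open>A\<close>, \<open>C\<close> the total
  excess of the doubled weights, \<open>m\<close> the number of neighbours outside \<open>A\<close>, and \<open>1 + m + m * m\<close> the number of vertices within
  distance two outside \<open>A\<close>. At most \<open>C + 2\<close> vertices have to be avoided at the same time.
\<close>

definition order_bound :: "nat \<Rightarrow> nat" where
  "order_bound r = (let C = 4 * (r - 1)\<^sup>2; m = C + 2 in 2 * (r - 1) + C + (C + 2) * (1 + m + m * m))"

context nonuniversal_semisat
begin

text \<open>
  The degree condition enters twice: a vertex with \<open>r - 2\<close> neighbours in \<open>A\<close> has at least two outside, so
  that the weights are at least \<open>r - 1\<close>, and a vertex with \<open>r - 1\<close> neighbours in \<open>A\<close> has another one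
  outside, so that it is not tight. The function \<open>w\<close> below is twice the weight.
\<close>

lemma card_V_le_of_min_degree:
  assumes deg: "\<And>v. v \<in> V \<Longrightarrow> r \<le> card (N v)"
    and few: "card E < (r - 1) * card V"
  shows "card V \<le> order_bound r"
proof (rule ccontr)
  define C where "C = 4 * (r - 1)\<^sup>2"
  define m where "m = C + 2"
  define L where "L = 1 + m + m * m"
  assume "\<not> card V \<le> order_bound r"
  then have large: "2 * (r - 1) + C + (C + 2) * L < card V"
    by (simp add: order_bound_def C_def m_def L_def Let_def)
  obtain x where x: "x \<in> V" "card (N x) < 2 * (r - 1)"
  proof (rule ccontr)
    assume "\<not> thesis"
    then have "2 * (r - 1) \<le> card (N v \<inter> V)" if "v \<in> V" for v
      using that nbhd_subset[of v] \<open>\<And>x. x \<in> V \<Longrightarrow> card (N x) < 2 * (r - 1) \<Longrightarrow> thesis\<close>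
      by (metis Diff_subset Int_absorb2 linorder_not_less order_trans)
    then have "(\<Sum>v\<in>V. 2 * (r - 1)) \<le> (\<Sum>v\<in>V. card (N v \<inter> V))"
      by (rule sum_mono)
    then show False
      using few handshake[OF fin] edges_in_V by (simp add: mult.commute)
  qed
  define A where "A = insert x (N x)"
  define R where "R = V - A"
  have A_V: "A \<subseteq> V" and finA: "finite A" and finR: "finite R"
    using x nbhd_subset[of x] finite_nbhd fin by (auto simp: A_def R_def)
  have cA: "card A \<le> 2 * (r - 1)"
    using x(2) finite_nbhd[of x] by (simp add: A_def card_insert_if)
  have cV: "card V = card A + card R"
    using A_V fin finA card_mono[OF fin A_V] by (simp add: R_def card_Diff_subset)
  have N_split: "card (N v) = card (N v \<inter> A) + card (N v \<inter> R)" for v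
  proof -
    have "N v = (N v \<inter> A) \<union> (N v \<inter> R)"
      using nbhd_subset[of v] by (auto simp: R_def)
    then show ?thesis
      using card_Un_disjoint[of "N v \<inter> A" "N v \<inter> R"] finite_nbhd[of v] by (auto simp: R_def)
  qed
  have A_clique: "\<exists>Q. Q \<subseteq> N v \<inter> A \<and> card Q = r - 2 \<and> clique Q E" if "v \<in> R" for v
  proof -
    have "v \<in> V" "v \<noteq> x" "v \<notin> N x"
      using that by (auto simp: R_def A_def)
    then obtain Q where "Q \<subseteq> N v \<inter> N x" "card Q = r - 2" "clique Q E"
      using sat x(1) by blast
    then show ?thesis by (auto simp: A_def)
  qed
  have dA: "r - 2 \<le> card (N v \<inter> A)" if v: "v \<in> R" for v
  proof -
    obtain Q where "Q \<subseteq> N v \<inter> A" "card Q = r - 2"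
      using A_clique[OF v] by blast
    then show ?thesis
      using card_mono[of "N v \<inter> A" Q] finA by simp
  qed
  define w where "w v = 2 * card (N v \<inter> A) + card (N v \<inter> R)" for v
  have w_ge: "2 * (r - 1) \<le> w v" if "v \<in> R" for v
    using dA[OF that] deg[of v] N_split[of v] that r4 by (auto simp: w_def R_def)
  have "(\<Sum>v\<in>R. w v) \<le> 2 * card E"
  proof -
    have "A \<union> R = V" using A_V by (auto simp: R_def)
    then have "card E = e_in A + e_in R + (\<Sum>v\<in>R. card (N v \<inter> A))"
      using e_in_Un[OF finR, of A] edges_in_V by (simp add: R_def)
    moreover have "(\<Sum>v\<in>R. card (N v \<inter> R)) = 2 * e_in R"
      by (rule handshake[OF finR])
    ultimately show ?thesis
      by (simp add: w_def sum.distrib flip: sum_distrib_left)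
  qed
  moreover have "(\<Sum>v\<in>R. w v) = (\<Sum>v\<in>R. w v - 2 * (r - 1)) + card R * (2 * (r - 1))"
  proof -
    have "(\<Sum>v\<in>R. w v) = (\<Sum>v\<in>R. (w v - 2 * (r - 1)) + 2 * (r - 1))"
      using w_ge by (intro sum.cong) auto
    then show ?thesis
      by (simp add: sum.distrib)
  qed
  moreover have "2 * card E < card R * (2 * (r - 1)) + 2 * (r - 1) * card A"
    using few cV by (simp add: algebra_simps)
  moreover have "2 * (r - 1) * card A \<le> C"
    using mult_le_mono2[OF cA, of "2 * (r - 1)"] by (simp add: C_def power2_eq_square algebra_simps)
  ultimately have excess: "(\<Sum>v\<in>R. w v - 2 * (r - 1)) \<le> C"
    by linarith
  have dR: "card (N v \<inter> R) \<le> m" if "v \<in> R" for v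
  proof -
    have "w v - 2 * (r - 1) \<le> C"
      using member_le_sum[OF that, of "\<lambda>v. w v - 2 * (r - 1)"] finR excess by simp
    then show ?thesis
      using dA[OF that] r4 by (simp add: w_def m_def)
  qed
  define Z where "Z = {v \<in> R. w v = 2 * (r - 1)}"
  have Z_R: "Z \<subseteq> R" and finZ: "finite Z"
    using finR by (auto simp: Z_def)
  have "card (R - Z) \<le> (\<Sum>v\<in>R - Z. w v - 2 * (r - 1))"
  proof -
    have "(\<Sum>v\<in>R - Z. 1) \<le> (\<Sum>v\<in>R - Z. w v - 2 * (r - 1))"
    proof (rule sum_mono)
      fix v assume "v \<in> R - Z"
      then show "1 \<le> w v - 2 * (r - 1)"
        using w_ge[of v] by (auto simp: Z_def)
    qed
    then show ?thesis by simp
  qed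
  also have "\<dots> \<le> (\<Sum>v\<in>R. w v - 2 * (r - 1))"
    using finR by (intro sum_mono2) auto
  finally have cRZ: "card (R - Z) \<le> C"
    using excess by simp
  have dAZ: "card (N v \<inter> A) = r - 2" if "v \<in> Z" for v
    using that dA[of v] deg[of v] N_split[of v] r4 by (auto simp: Z_def w_def R_def)
  define near where "near v = insert v (N v \<inter> R) \<union> (\<Union>u\<in>N v \<inter> R. N u \<inter> R)" for v
  have card_near: "card (near v) \<le> L" if "v \<in> R" for v
  proof -
    have "card (\<Union>u\<in>N v \<inter> R. N u \<inter> R) \<le> (\<Sum>u\<in>N v \<inter> R. card (N u \<inter> R))"
      using finR by (intro card_UN_le) auto
    also have "\<dots> \<le> (\<Sum>u\<in>N v \<inter> R. m)"
      using dR by (intro sum_mono) auto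
    also have "\<dots> \<le> m * m"
      using dR[OF that] by simp
    finally have "card (\<Union>u\<in>N v \<inter> R. N u \<inter> R) \<le> m * m" .
    moreover have "card (insert v (N v \<inter> R)) \<le> 1 + m"
      using dR[OF that] finR by (simp add: card_insert_if)
    ultimately show ?thesis
      using card_Un_le[of "insert v (N v \<inter> R)" "\<Union>u\<in>N v \<inter> R. N u \<inter> R"]
      by (simp add: near_def L_def)
  qed
  have far: "\<exists>y\<in>Z. \<forall>v\<in>S. y \<notin> near v" if "S \<subseteq> R" "card S \<le> C + 2" for S
  proof (rule ccontr)
    assume "\<not> ?thesis"
    then have "Z \<subseteq> (\<Union>v\<in>S. near v)" by blast
    moreover have "finite S" using that(1) finR finite_subset by blast
    moreover have "finite (near v)" for v
      using finR by (simp add: near_def)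
    ultimately have "card Z \<le> card (\<Union>v\<in>S. near v)"
      by (intro card_mono) auto
    also have "\<dots> \<le> (\<Sum>v\<in>S. card (near v))"
      using \<open>finite S\<close> by (rule card_UN_le)
    also have "\<dots> \<le> (\<Sum>v\<in>S. L)"
      using card_near that(1) by (intro sum_mono) auto
    also have "\<dots> \<le> (C + 2) * L"
      using mult_le_mono1[OF that(2), of L] by simp
    finally have "card Z \<le> (C + 2) * L" .
    moreover have "card R = card Z + card (R - Z)"
      using finZ Z_R finR card_mono[OF finR Z_R] by (simp add: card_Diff_subset)
    ultimately show False
      using large cV cA cRZ by linarith
  qed
  have farD: "y \<noteq> v" "y \<notin> N v" "N y \<inter> N v \<subseteq> A" if "y \<in> Z" "v \<in> R" "y \<notin> near v" for y v
  proof -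
    show "y \<noteq> v" "y \<notin> N v"
      using that Z_R by (auto simp: near_def)
    show "N y \<inter> N v \<subseteq> A"
    proof
      fix u assume u: "u \<in> N y \<inter> N v"
      show "u \<in> A"
      proof (rule ccontr)
        assume "u \<notin> A"
        then have "u \<in> N v \<inter> R"
          using u nbhd_subset[of v] by (auto simp: R_def)
        moreover have "y \<in> N u \<inter> R"
          using u that(1) Z_R nbhd_symD[of u E y] by blast
        ultimately show False
          using that(3) by (auto simp: near_def)
      qed
    qed
  qed
  have same_type: "N y \<inter> A = N v \<inter> A" if yv: "y \<in> Z" "v \<in> Z" "y \<notin> near v" for y v
  proof -
    have vR: "v \<in> R" using yv(2) Z_R by blast
    have "y \<in> V" "v \<in> V" using yv Z_R by (auto simp: R_def)
    then obtain Q where Q: "Q \<subseteq> N y \<inter> N v" "card Q = r - 2"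
      using sat farD(1,2)[OF yv(1) vR yv(3)] by blast
    have "Q \<subseteq> A" using Q(1) farD(3)[OF yv(1) vR yv(3)] by blast
    then have "Q \<subseteq> N y \<inter> A" "Q \<subseteq> N v \<inter> A" using Q(1) by auto
    then have "Q = N y \<inter> A" "Q = N v \<inter> A"
      using Q(2) dAZ[OF yv(1)] dAZ[OF yv(2)] finA by (simp_all add: card_subset_eq)
    then show ?thesis by simp
  qed
  obtain y0 where y0: "y0 \<in> Z" using far[of "{}"] by auto
  define K where "K = N y0 \<inter> A"
  have type_K: "N z \<inter> A = K" if z: "z \<in> Z" for z
  proof -
    have "{y0, z} \<subseteq> R" using z y0 Z_R by blast
    moreover have "card {y0, z} \<le> C + 2" by (simp add: card_insert_if)
    ultimately obtain u where u: "u \<in> Z" "\<forall>v\<in>{y0, z}. u \<notin> near v"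
      using far[of "{y0, z}"] by blast
    have "N u \<inter> A = N y0 \<inter> A"
      using u by (intro same_type y0) auto
    moreover have "N u \<inter> A = N z \<inter> A"
      using u by (intro same_type z) auto
    ultimately show ?thesis by (simp add: K_def)
  qed
  have cK: "card K = r - 2"
    using dAZ[OF y0] by (simp add: K_def)
  have K_clique: "clique K E"
  proof -
    obtain Q where Q: "Q \<subseteq> K" "card Q = r - 2" "clique Q E"
      using A_clique[of y0] y0 Z_R by (auto simp: K_def)
    then have "Q = K"
      using cK finA by (intro card_subset_eq) (auto simp: K_def)
    with Q show ?thesis by simp
  qed
  obtain k where k: "k \<in> K"
    using cK r4 by fastforce
  then have "k \<in> V" using A_V by (auto simp: K_def)
  then obtain u where u: "u \<in> V" "u \<noteq> k" "u \<notin> N k"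
    using nonuniversal by blast
  have uK: "u \<notin> K"
    using K_clique k u by (auto simp: clique_def in_nbhd_iff)
  \<comment> \<open>Far from \<open>S\<close>, all neighbours of \<open>y\<close> outside \<open>A\<close> are tight, and none of them is adjacent to \<open>u\<close> if
    \<open>u\<close> lies outside \<open>A\<close>. A common clique of \<open>y\<close> and \<open>u\<close> needs a vertex \<open>z\<close> besides \<open>K - {k}\<close>; it lies
    outside \<open>A\<close>, so \<open>u\<close> lies in \<open>A\<close>, hence in the neighbourhood \<open>K\<close> of the tight vertex \<open>z\<close>.\<close>
  define S where "S = (R - Z) \<union> ({u} \<inter> R)"
  have "card ({u} \<inter> R) \<le> 1"
    by (simp add: card_insert_if Int_insert_left)
  then have "card S \<le> C + 2"
    using cRZ card_Un_le[of "R - Z" "{u} \<inter> R"] by (simp add: S_def)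
  then obtain y where y: "y \<in> Z" and y_far: "\<And>v. v \<in> S \<Longrightarrow> y \<notin> near v"
    using far[of S] by (auto simp: S_def)
  have yu: "y \<noteq> u \<and> y \<notin> N u"
  proof (cases "u \<in> R")
    case True
    then show ?thesis
      using farD[of y u] y y_far[of u] by (simp add: S_def)
  next
    case False
    then have "u \<in> A" using u(1) by (simp add: R_def)
    then have "y \<noteq> u" "u \<notin> N y"
      using y Z_R type_K[OF y] uK unfolding R_def by blast+
    then show ?thesis
      using nbhd_symD[of y E u] by blast
  qed
  have "y \<in> V" using y Z_R by (auto simp: R_def)
  then obtain Q where Q: "Q \<subseteq> N y \<inter> N u" "card Q = r - 2"
    using sat[of y u] u(1) yu by blast
  have "\<not> Q \<subseteq> K - {k}"
  proof
    assume "Q \<subseteq> K - {k}"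
    then have "card Q \<le> card (K - {k})"
      using finA by (intro card_mono) (auto simp: K_def)
    then show False
      using cK k Q(2) r4 by simp
  qed
  moreover have "k \<notin> Q"
    using Q(1) u(3) nbhd_symD[of k E u] by blast
  ultimately obtain z where z: "z \<in> Q" "z \<notin> K" by blast
  then have zy: "z \<in> N y" "z \<in> N u" using Q(1) by auto
  have "z \<notin> A"
    using zy(1) z(2) type_K[OF y] by blast
  then have zR: "z \<in> R"
    using zy(1) nbhd_subset[of y] by (auto simp: R_def)
  have "z \<in> Z"
  proof (rule ccontr)
    assume "z \<notin> Z"
    then have "y \<notin> N z"
      using farD(2)[OF y zR] y_far[of z] zR by (simp add: S_def)
    then show False using nbhd_symD[OF zy(1)] by blast
  qed
  have "u \<notin> R"
  proof
    assume "u \<in> R"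
    then have "N y \<inter> N u \<subseteq> A"
      using farD(3)[OF y] y_far[of u] by (simp add: S_def)
    then show False using zy \<open>z \<notin> A\<close> by blast
  qed
  then have "u \<in> N z \<inter> A"
    using u(1) nbhd_symD[OF zy(2)] by (auto simp: R_def)
  then show False
    using type_K[OF \<open>z \<in> Z\<close>] uK by blast
qed

end

section \<open>The lower bound on the number of edges\<close>

lemma two_times_choose_2: "2 * (s choose 2) = s * (s - 1)"
proof -
  have "even (s * (s - 1))" by (cases s) simp_all
  then show ?thesis by (simp add: choose_two)
qed

lemma max_degree_le_iff:
  assumes "finite V"
  shows "max_degree (V, E) \<le> k \<longleftrightarrow> (\<forall>v\<in>V. degree (V, E) v \<le> k)"
  using assms by (simp add: max_degree_def)

lemma card_edges_ge:
  assumes G: "simple_graph (V, E)" "semi_saturated (complete_graph r) (V, E)"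
    and deg: "max_degree (V, E) \<le> card V - 2"
    and large: "order_bound r < card V" and r4: "r \<ge> 4"
  shows "(r - 1) * card V - r * (r - 1) div 2 \<le> card E \<or>
    r = 4 \<and> (r - 1) * card V - r * (r - 1) div 2 - 1 \<le> card E \<and> card V - 2 \<le> max_degree (V, E)"
proof -
  interpret fin_graph V E
    using G(1) by unfold_locales (auto simp: simple_graph_def)
  have "2 * (r - 1) \<le> order_bound r"
    by (simp add: order_bound_def Let_def)
  then have n: "6 < card V" using large r4 by linarith
  have nonuniv: "\<exists>w\<in>V. w \<noteq> v \<and> w \<notin> N v" if "v \<in> V" for v
  proof (rule ccontr)
    assume "\<not> ?thesis"
    then have "card (V - {v}) \<le> card (N v)"
      by (intro card_mono finite_nbhd) blast
    moreover have "card (N v) \<le> card V - 2"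
      using deg that by (simp add: max_degree_le_iff fin degree_eq_card_nbhd)
    ultimately show False
      using that n by simp
  qed
  interpret nonuniversal_semisat V E r
  proof
    fix u v assume "u \<in> V" "v \<in> V" "u \<noteq> v" "u \<notin> N v"
    then show "\<exists>Q. Q \<subseteq> N u \<inter> N v \<and> card Q = r - 2 \<and> clique Q E"
      using G r4 by (simp add: semi_saturated_complete_graph_iff in_nbhd_iff)
  qed (use r4 nonuniv in auto)
  show ?thesis
  proof (cases "\<forall>v\<in>V. r \<le> card (N v)")
    case True
    then have "(r - 1) * card V \<le> card E"
      using card_V_le_of_min_degree large by (meson not_le)
    then show ?thesis by (intro disjI1) (rule le_trans[OF diff_le_self])
  next
    case False
    then obtain y where y: "y \<in> V" "card (N y) < r" by (auto simp: not_le)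
    then have "card (N y) = r - 1"
      using card_nbhd_ge[of y] by simp
    with y interpret min_degree_vertex V E r y
      by unfold_locales
    obtain s where s: "r = Suc s" using r4 by (cases r) auto
    have choose: "r * (r - 1) div 2 = r choose 2"
      by (simp add: choose_two)
    have "(r - 1 choose 2) + (r choose 2) = (r - 1) * (r - 1)"
      using two_times_choose_2[of "r - 1"] two_times_choose_2[of r] s by (cases s) simp_all
    moreover have "(r - 1) * card V = (r - 1) * card B + (r - 1) * (r - 1)"
      using card_B by (metis add_mult_distrib2)
    ultimately have eq: "(r - 1) * card B + (r - 1 choose 2) = (r - 1) * card V - r * (r - 1) div 2"
      unfolding choose by linarith
    have "card V - 2 \<le> max_degree (V, E)" if "b \<in> V" "card V - 2 \<le> card (N b)" for b
      using max_degree_le_iff[OF fin, of E "max_degree (V, E)"] that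
      by (auto simp: degree_eq_card_nbhd intro: order_trans)
    moreover have "(r - 1 choose 2) = 3" if "r = 4"
      using that by (simp add: choose_two)
    ultimately show ?thesis
      using card_E_ge eq by fastforce
  qed
qed

section \<open>Graphs attaining the bound\<close>

text \<open>
  The vertices below \<open>r\<close> form a clique, and \<open>v \<ge> r\<close> is joined to all of them except \<open>v mod r\<close>. As \<open>v mod r = v\<close>
  for \<open>v < r\<close>, every vertex \<open>v\<close> is adjacent to all vertices below \<open>r\<close> other than \<open>v mod r\<close>. The residues
  spread the missing edges so evenly that every vertex below \<open>r\<close> has at least \<open>(n - r) div r\<close> nonneighbours.
\<close>

definition residue_edges :: "nat \<Rightarrow> nat \<Rightarrow> nat set set" where
  "residue_edges r n = {{u, v} | u v. u < v \<and> v < n \<and> (v < r \<or> u < r \<and> v mod r \<noteq> u)}"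

lemma residue_edges_iff:
  "u < v \<Longrightarrow> {u, v} \<in> residue_edges r n \<longleftrightarrow> v < n \<and> (v < r \<or> u < r \<and> v mod r \<noteq> u)"
  by (auto simp: residue_edges_def doubleton_eq_iff)

lemma residue_graph:
  assumes r: "r \<ge> 2" "r \<le> n" and \<Delta>: "n - 1 - (n - r) div r \<le> \<Delta>"
  shows "simple_graph ({..<n}, residue_edges r n)"
    and "semi_saturated (complete_graph r) ({..<n}, residue_edges r n)"
    and "max_degree ({..<n}, residue_edges r n) \<le> \<Delta>"
    and "card (residue_edges r n) = (r - 1) * n - r * (r - 1) div 2"
proof -
  let ?E = "residue_edges r n"
  have E: "?E \<subseteq> nsets {..<n} 2"
    by (auto simp: residue_edges_def)
  then show simple: "simple_graph ({..<n}, ?E)"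
    by (simp add: simple_graph_def)
  interpret fin_graph "{..<n}" ?E
    using E by unfold_locales auto
  have clique: "clique {..<r} ?E"
    unfolding clique_def
  proof (intro ballI impI)
    fix u v assume "u \<in> {..<r}" "v \<in> {..<r}" "u \<noteq> v"
    then show "{u, v} \<in> ?E"
      using residue_edges_iff[of u v r n] residue_edges_iff[of v u r n] r
      by (cases u v rule: linorder_cases) (auto simp: insert_commute)
  qed
  have outer: "N v = {..<r} - {v mod r}" if "v \<in> {r..<n}" for v
  proof
    show "{..<r} - {v mod r} \<subseteq> N v"
      using that residue_edges_iff[of _ v r n] by (auto simp: in_nbhd_iff)
    show "N v \<subseteq> {..<r} - {v mod r}"
    proof
      fix u assume "u \<in> N v"
      then show "u \<in> {..<r} - {v mod r}"
        using that residue_edges_iff[of u v r n] residue_edges_iff[of v u r n] nbhd_irrefl[of v]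
        by (cases u v rule: linorder_cases) (auto simp: in_nbhd_iff insert_commute)
    qed
  qed
  have core: "{..<r} - {v mod r} \<subseteq> N v" if "v < n" for v
  proof (cases "v < r")
    case True
    then show ?thesis
      using clique by (auto simp: clique_def nbhd_def)
  next
    case False
    then show ?thesis using outer[of v] that by simp
  qed
  show "semi_saturated (complete_graph r) ({..<n}, ?E)"
    unfolding semi_saturated_complete_graph_iff[OF simple r(1)]
  proof (intro ballI impI)
    fix u v assume uv: "u \<in> {..<n}" "v \<in> {..<n}"
    let ?R = "{..<r} - {u mod r, v mod r}"
    have "card {u mod r, v mod r} \<le> 2"
      by (simp add: card_insert_if)
    then have "r - 2 \<le> card ?R"
      using diff_card_le_card_Diff[of "{u mod r, v mod r}" "{..<r}"] by simp
    then obtain Q where Q: "Q \<subseteq> ?R" "card Q = r - 2"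
      using obtain_subset_with_card_n by metis
    have "Q \<subseteq> N u \<inter> N v"
      using Q(1) core[of u] core[of v] uv by blast
    moreover have "clique Q ?E"
      using Q(1) clique by (auto intro: smaller_clique)
    ultimately show "\<exists>Q. Q \<subseteq> N u \<inter> N v \<and> card Q = r - 2 \<and> clique Q ?E"
      using Q(2) by blast
  qed
  have "card (N v) \<le> n - 1 - (n - r) div r" if "v < n" for v
  proof (cases "v < r")
    case False
    have "(n - r) div r \<le> n - r"
      by (rule div_le_dividend)
    moreover have "card (N v) = r - 1"
      using False that r outer[of v] by simp
    ultimately show ?thesis using r by linarith
  next
    case True
    \<comment> \<open>nonneighbours of \<open>v\<close> in the residue class of \<open>v\<close>\<close>
    let ?M = "(\<lambda>i. r * i + v) ` {1..(n - r) div r}"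
    have "card ?M = (n - r) div r"
      using r by (subst card_image) (auto simp: inj_on_def)
    have M: "r \<le> w" "w < n" "w mod r = v" if "w \<in> ?M" for w
    proof -
      obtain i where i: "1 \<le> i" "i \<le> (n - r) div r" "w = r * i + v"
        using \<open>w \<in> ?M\<close> by auto
      have "r * i \<le> r * ((n - r) div r)"
        using i(2) by simp
      also have "\<dots> \<le> n - r"
        by simp
      finally show "w < n" using i(3) True r by simp
      show "w mod r = v" using i(3) True by simp
      have "r * 1 \<le> r * i" using i(1) by (intro mult_le_mono2)
      then show "r \<le> w" using i(3) by linarith
    qed
    have "N v \<subseteq> ({..<n} - {v}) - ?M"
    proof
      fix w assume w: "w \<in> N v"
      have "w \<notin> ?M"
      proof
        assume "w \<in> ?M"
        then have "v \<notin> N w"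
          using M[of w] outer[of w] by simp
        then show False
          using w nbhd_symD[of w ?E v] by blast
      qed
      then show "w \<in> ({..<n} - {v}) - ?M"
        using w nbhd_subset[of v] by blast
    qed
    then have "card (N v) \<le> card (({..<n} - {v}) - ?M)"
      by (intro card_mono) auto
    also have "\<dots> = card ({..<n} - {v}) - card ?M"
      using M True by (intro card_Diff_subset) force+
    also have "\<dots> = n - 1 - (n - r) div r"
      using that \<open>card ?M = _\<close> by simp
    finally show ?thesis .
  qed
  then show "max_degree ({..<n}, ?E) \<le> \<Delta>"
    using \<Delta> by (auto simp: max_degree_le_iff degree_eq_card_nbhd intro: order_trans)
  have "edges_in ?E {r..<n} = {}"
    by (auto simp: edges_in_def residue_edges_def)
  moreover have "(\<Sum>v\<in>{r..<n}. card (N v \<inter> {..<r})) = (\<Sum>v\<in>{r..<n}. r - 1)"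
  proof (rule sum.cong)
    fix v assume "v \<in> {r..<n}"
    then show "card (N v \<inter> {..<r}) = r - 1"
      using outer[of v] r by (simp add: Int_absorb2 Diff_subset)
  qed simp
  moreover have "{..<r} \<union> {r..<n} = {..<n}" "{..<r} \<inter> {r..<n} = {}"
    using r by auto
  moreover have "e_in {..<r} = r choose 2"
    using e_in_clique[OF _ _ clique] r by auto
  ultimately have "card ?E = (r choose 2) + (n - r) * (r - 1)"
    using e_in_Un[of "{r..<n}" "{..<r}"] edges_in_V by simp
  moreover have "(n - r) * (r - 1) + r * (r - 1) = (r - 1) * n"
    using r by (simp add: mult.commute flip: add_mult_distrib)
  ultimately show "card ?E = (r - 1) * n - r * (r - 1) div 2"
    using two_times_choose_2[of r] by linarith
qed

text \<open>
  The complete bipartite graph between \<open>{0, 1, 2}\<close> and the rest, with one more edge on each side. Either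
  edge is the clique of size \<open>2\<close> needed by the nonadjacent pairs of the other side.
\<close>

definition exceptional_edges :: "nat \<Rightarrow> nat set set" where
  "exceptional_edges n = {{0, 1}, {3, 4}} \<union> {{i, j} | i j. i < 3 \<and> 3 \<le> j \<and> j < n}"

lemma exceptional_graph:
  assumes n: "n \<ge> 6"
  shows "simple_graph ({..<n}, exceptional_edges n)"
    and "semi_saturated (complete_graph 4) ({..<n}, exceptional_edges n)"
    and "max_degree ({..<n}, exceptional_edges n) \<le> n - 2"
    and "card (exceptional_edges n) = 3 * n - 7"
proof -
  let ?E = "exceptional_edges n"
  have E: "?E \<subseteq> nsets {..<n} 2"
    using n by (auto simp: exceptional_edges_def)
  then show simple: "simple_graph ({..<n}, ?E)"
    by (simp add: simple_graph_def)
  interpret fin_graph "{..<n}" ?E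
    using E by unfold_locales auto
  have cross: "{i, j} \<in> ?E" if "i < 3" "3 \<le> j" "j < n" for i j
    using that unfolding exceptional_edges_def by blast
  have low: "{3..<n} \<subseteq> N i" if "i < 3" for i
    using cross[OF that] by (auto simp: in_nbhd_iff insert_commute)
  have high: "{..<3} \<subseteq> N j" if "3 \<le> j" "j < n" for j
    using cross that by (auto simp: in_nbhd_iff)
  show "semi_saturated (complete_graph 4) ({..<n}, ?E)"
    unfolding semi_saturated_complete_graph_iff[OF simple, of 4, simplified]
  proof (intro ballI impI)
    fix u v assume uv: "u \<in> {..<n}" "v \<in> {..<n}" "u \<noteq> v" "{u, v} \<notin> ?E"
    show "\<exists>Q. Q \<subseteq> N u \<and> Q \<subseteq> N v \<and> card Q = 2 \<and> clique Q ?E"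
    proof (cases "u < 3")
      case True
      then have "\<not> 3 \<le> v"
        using cross[of u v] uv by blast
      then have "v < 3" by simp
      then have "{3, 4} \<subseteq> N u" "{3, 4} \<subseteq> N v"
        using low[of u] low[of v] True n by auto
      moreover have "clique {3, 4} ?E"
        by (auto simp: clique_def exceptional_edges_def insert_commute)
      ultimately show ?thesis
        by (intro exI[of _ "{3, 4}"]) simp
    next
      case False
      then have "\<not> v < 3"
        using cross[of v u] uv by (auto simp: insert_commute)
      then have "3 \<le> v" by simp
      then have "{0, 1} \<subseteq> N u" "{0, 1} \<subseteq> N v"
        using high[of u] high[of v] False uv by auto
      moreover have "clique {0, 1} ?E"
        by (auto simp: clique_def exceptional_edges_def insert_commute)
      ultimately show ?thesis
        by (intro exI[of _ "{0, 1}"]) simp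
    qed
  qed
  have "card (N v) \<le> n - 2" if "v < n" for v
  proof -
    define w :: nat where "w = (if v < 2 then 2 else if v = 2 then 0 else if v < 5 then 5 else 3)"
    have "w \<notin> N v" "w \<noteq> v" "w < n"
      using n by (auto simp: w_def in_nbhd_iff exceptional_edges_def doubleton_eq_iff)
    then have "N v \<subseteq> {..<n} - {v, w}"
      using nbhd_subset[of v] by blast
    then have "card (N v) \<le> card ({..<n} - {v, w})"
      by (intro card_mono) auto
    also have "\<dots> = n - 2"
      using \<open>w \<noteq> v\<close> \<open>w < n\<close> that by (subst card_Diff_subset) auto
    finally show ?thesis .
  qed
  then show "max_degree ({..<n}, ?E) \<le> n - 2"
    by (simp add: max_degree_le_iff degree_eq_card_nbhd)
  have "\<not> {i, j} \<subseteq> {..<3}" if "3 \<le> j" for i j :: nat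
    using that by simp
  then have "edges_in ?E {..<3} = {{0, 1}}"
    unfolding edges_in_def exceptional_edges_def by fastforce
  moreover have "\<not> {i, j} \<subseteq> {3..<n}" if "i < 3" for i j :: nat
    using that by simp
  then have "edges_in ?E {3..<n} = {{3, 4}}"
    using n unfolding edges_in_def exceptional_edges_def by fastforce
  moreover have "(\<Sum>v\<in>{3..<n}. card (N v \<inter> {..<3})) = (\<Sum>v\<in>{3..<n}. 3)"
  proof (rule sum.cong)
    fix v assume "v \<in> {3..<n}"
    then show "card (N v \<inter> {..<3}) = 3"
      using high[of v] by (simp add: Int_absorb1)
  qed simp
  moreover have "{..<3} \<union> {3..<n} = {..<n}" "{..<3} \<inter> {3..<n} = {}"
    using n by auto
  ultimately have "card ?E = 2 + (n - 3) * 3"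
    using e_in_Un[of "{3..<n}" "{..<3}"] edges_in_V by simp
  then show "card ?E = 3 * n - 7"
    using n by simp
qed

lemma ssat_eqI:
  assumes "simple_graph ({..<n}, E)" "semi_saturated F ({..<n}, E)"
    and "max_degree ({..<n}, E) \<le> \<Delta>" "card E = m"
    and lower: "\<And>E. simple_graph ({..<n}, E) \<Longrightarrow> semi_saturated F ({..<n}, E) \<Longrightarrow>
      max_degree ({..<n}, E) \<le> \<Delta> \<Longrightarrow> m \<le> card E"
  shows "ssat \<Delta> n F = enat m"
  unfolding ssat_def
proof (rule antisym)
  let ?S = "{enat (card (edges G)) | G :: nat graph.
     simple_graph G \<and> verts G = {..<n} \<and> semi_saturated F G \<and> max_degree G \<le> \<Delta>}"
  show "Inf ?S \<le> enat m"
    using assms(1-4) by (intro Inf_lower CollectI exI[of _ "({..<n}, E)"]) simp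
  show "enat m \<le> Inf ?S"
  proof (rule Inf_greatest)
    fix x assume "x \<in> ?S"
    then obtain G :: "nat graph" where "x = enat (card (edges G))" "simple_graph G"
      "verts G = {..<n}" "semi_saturated F G" "max_degree G \<le> \<Delta>" by blast
    then show "enat m \<le> x"
      using lower[of "edges G"] by (cases G) simp
  qed
qed

theorem theorem1p7:
  fixes r :: nat
  assumes "r \<ge> 4"
  shows "\<exists>N. \<forall>n\<ge>N. \<forall>\<Delta>::nat. n - 1 - (n - r) div r \<le> \<Delta> \<and> \<Delta> \<le> n - 2 \<longrightarrow>
    ssat \<Delta> n (complete_graph r) =
      (if r = 4 \<and> \<Delta> = n - 2
       then enat ((r - 1) * n - (r * (r - 1)) div 2 - 1)
       else enat ((r - 1) * n - (r * (r - 1)) div 2))"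
proof (intro exI[of _ "order_bound r + 1"] allI impI)
  fix n \<Delta> :: nat
  assume n: "order_bound r + 1 \<le> n" and \<Delta>: "n - 1 - (n - r) div r \<le> \<Delta> \<and> \<Delta> \<le> n - 2"
  have "2 * (r - 1) \<le> order_bound r"
    by (simp add: order_bound_def Let_def)
  then have rn: "r \<le> n" "6 \<le> n" "r \<ge> 2"
    using n assms by linarith+
  note lower = card_edges_ge[of "{..<n}" _ r, simplified, OF _ _ _ _ assms]
  show "ssat \<Delta> n (complete_graph r) =
      (if r = 4 \<and> \<Delta> = n - 2
       then enat ((r - 1) * n - (r * (r - 1)) div 2 - 1)
       else enat ((r - 1) * n - (r * (r - 1)) div 2))"
  proof (cases "r = 4 \<and> \<Delta> = n - 2")
    case True
    have "ssat \<Delta> n (complete_graph r) = enat ((r - 1) * n - (r * (r - 1)) div 2 - 1)"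
    proof (rule ssat_eqI[OF exceptional_graph(1)[OF rn(2)]])
      fix E :: "nat set set"
      assume "simple_graph ({..<n}, E)" "semi_saturated (complete_graph r) ({..<n}, E)"
        "max_degree ({..<n}, E) \<le> \<Delta>"
      then show "(r - 1) * n - (r * (r - 1)) div 2 - 1 \<le> card E"
        using lower[of E] n True by fastforce
    qed (use exceptional_graph(2-4)[OF rn(2)] True in auto)
    with True show ?thesis by presburger
  next
    case False
    have "ssat \<Delta> n (complete_graph r) = enat ((r - 1) * n - (r * (r - 1)) div 2)"
    proof (rule ssat_eqI)
      fix E :: "nat set set"
      assume E: "simple_graph ({..<n}, E)" "semi_saturated (complete_graph r) ({..<n}, E)"
        "max_degree ({..<n}, E) \<le> \<Delta>"
      then have "r = 4 \<Longrightarrow> max_degree ({..<n}, E) < n - 2"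
        using \<Delta> False by linarith
      then show "(r - 1) * n - (r * (r - 1)) div 2 \<le> card E"
        using lower[of E] E n \<Delta> by fastforce
    qed (use residue_graph[OF rn(3,1)] \<Delta> in auto)
    with False show ?thesis by presburger
  qed
qed

end
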